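(* Let $A=\{a_{ij}\}_{i,j=0,1,2,\ldots}$ be a double sequence of complex constants that defines a regular method of summability, and let $g(z)=\sum_{i=0}^{\infty} g_i z^i$ be a complex power series. Then for any complex number $z$ the following two conditions are equivalent: (i) $\lim_{i\to\infty} g_i z^i = 1$; (ii) the double sequence $P^{C}_{A;g}(z)=\{a_{ij}\,g_i\,z^{i}\}_{i,j=0,1,2,\ldots}$ defines a regular method of summability.
   Context: Let $c$ be the space of all convergent sequences of complex scalars. A double sequence $B=\{b_{ij}\}_{i,j=0,1,2,\ldots}$ of complex constants is said to define a regular method of summability if the formula $T[s_0,s_1,\ldots]=[t_0,t_1,\ldots]$, with $t_i=\sum_{j=0}^{\infty} b_{ij}s_j$ for $i=0,1,2,\ldots$, defines a linear transformation $T$ of $c$ into itself (in particular all the series converge for every $[s_j]\in c$) which preserves limits, i.e. $\lim_{i\to\infty}t_i=\lim_{i\to\infty}s_i$ for every $[s_i]\in c$. The convention $z^0=1$ is used for all $z$, including $z=0$. *)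

theory Defs
  imports Complex_Main "HOL-Computational_Algebra.Formal_Power_Series"
begin

definition conv_seqs :: "(nat \<Rightarrow> complex) set" where
  "conv_seqs = {s. convergent s}"

definition matrix_transform :: "(nat \<Rightarrow> nat \<Rightarrow> complex) \<Rightarrow> (nat \<Rightarrow> complex) \<Rightarrow> nat \<Rightarrow> complex" where
  "matrix_transform B s i = (\<Sum>j. B i j * s j)"

(* Summability must be demanded separately, since suminf is total.  Linearity is
   over the complex scalars; it follows from the summability clause. *)
definition regular_summability :: "(nat \<Rightarrow> nat \<Rightarrow> complex) \<Rightarrow> bool" where
  "regular_summability B \<longleftrightarrow>
     (\<forall>s\<in>conv_seqs. \<forall>i. summable (\<lambda>j. B i j * s j)) \<and>
     matrix_transform B \<in> conv_seqs \<rightarrow> conv_seqs \<and>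
     (\<forall>s\<in>conv_seqs. \<forall>t\<in>conv_seqs. \<forall>\<alpha> \<beta>.
        matrix_transform B (\<lambda>j. \<alpha> * s j + \<beta> * t j) =
        (\<lambda>i. \<alpha> * matrix_transform B s i + \<beta> * matrix_transform B t i)) \<and>
     (\<forall>s\<in>conv_seqs. lim (matrix_transform B s) = lim s)"

(* The method P^C_{A;g}(z).  Only the coefficients of g enter, so g is a formal power
   series with no convergence requirement; z ^ 0 = 1 also for z = 0. *)
definition P_C :: "(nat \<Rightarrow> nat \<Rightarrow> complex) \<Rightarrow> complex fps \<Rightarrow> complex \<Rightarrow> nat \<Rightarrow> nat \<Rightarrow> complex" where
  "P_C A g z i j = A i j * fps_nth g i * z ^ i"

end

theory Submission
  imports Defs
begin

text \<open>
  Passing from \<open>A\<close> to \<open>P_C A g z\<close> multiplies row \<open>i\<close> by the scalar \<open>w i = fps_nth g i * z ^ i\<close>,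
  so the \<open>i\<close>-th transformed term is multiplied by \<open>w i\<close>
  (\<open>matrix_transform_scale_rows\<close>). If \<open>w\<close> tends to 1, this does not alter the limit of any
  transform. Conversely, the constant sequence 1 is the only test sequence needed: the transforms
  of it by \<open>A\<close> and by the rescaled matrix both tend to 1, and \<open>w i\<close> is the quotient of their
  \<open>i\<close>-th terms as soon as the denominator is nonzero. The argument applies to arbitrary
  row factors \<open>w\<close> (\<open>regular_summability_scale_rows_iff\<close>).
\<close>

text \<open>
  Linearity of the transform follows from convergence of the series, and mapping \<open>conv_seqs\<close>
  into itself while preserving \<open>lim\<close> amounts to preserving convergence to each given limit.
\<close>

lemma regular_summability_iff_tendsto:
  "regular_summability B \<longleftrightarrow>
     (\<forall>s l. s \<longlonglongrightarrow> l \<longrightarrow>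
        (\<forall>i. summable (\<lambda>j. B i j * s j)) \<and> matrix_transform B s \<longlonglongrightarrow> l)"
  (is "_ \<longleftrightarrow> ?R")
proof
  assume B: "regular_summability B"
  show ?R
  proof (intro allI impI)
    fix s :: "nat \<Rightarrow> complex" and l
    assume s: "s \<longlonglongrightarrow> l"
    then have mem: "s \<in> conv_seqs"
      by (auto simp: conv_seqs_def convergent_def)
    then have "convergent (matrix_transform B s)" and "lim (matrix_transform B s) = lim s"
      using B by (auto simp: regular_summability_def conv_seqs_def)
    then have "matrix_transform B s \<longlonglongrightarrow> l"
      using limI[OF s] by (simp add: convergent_LIMSEQ_iff)
    then show "(\<forall>i. summable (\<lambda>j. B i j * s j)) \<and> matrix_transform B s \<longlonglongrightarrow> l"
      using B mem by (simp add: regular_summability_def)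
  qed
next
  assume R: ?R
  have summ: "summable (\<lambda>j. B i j * s j)" if "s \<in> conv_seqs" for s i
    using R that by (auto simp: conv_seqs_def convergent_def)
  have tends: "matrix_transform B s \<longlonglongrightarrow> lim s" if "s \<in> conv_seqs" for s
    using R that by (simp add: conv_seqs_def convergent_LIMSEQ_iff)
  have "matrix_transform B (\<lambda>j. \<alpha> * s j + \<beta> * t j) =
        (\<lambda>i. \<alpha> * matrix_transform B s i + \<beta> * matrix_transform B t i)"
    if s: "s \<in> conv_seqs" and t: "t \<in> conv_seqs" for s t \<alpha> \<beta>
  proof
    fix i
    have "(\<lambda>j. \<alpha> * (B i j * s j) + \<beta> * (B i j * t j)) sums
          (\<alpha> * matrix_transform B s i + \<beta> * matrix_transform B t i)"
      unfolding matrix_transform_def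
      by (intro sums_add sums_mult summable_sums summ s t)
    moreover have "(\<lambda>j. B i j * (\<alpha> * s j + \<beta> * t j)) =
                   (\<lambda>j. \<alpha> * (B i j * s j) + \<beta> * (B i j * t j))"
      by (simp add: algebra_simps)
    ultimately show "matrix_transform B (\<lambda>j. \<alpha> * s j + \<beta> * t j) i =
        \<alpha> * matrix_transform B s i + \<beta> * matrix_transform B t i"
      by (simp add: matrix_transform_def sums_iff)
  qed
  moreover have "matrix_transform B \<in> conv_seqs \<rightarrow> conv_seqs"
    using tends by (auto simp: conv_seqs_def convergent_def)
  ultimately show "regular_summability B"
    using summ limI[OF tends] by (simp add: regular_summability_def)
qed

lemma matrix_transform_scale_rows:
  assumes "summable (\<lambda>j. B i j * s j)"
  shows "matrix_transform (\<lambda>i j. w i * B i j) s i = w i * matrix_transform B s i"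
  using suminf_mult[OF assms, of "w i"] by (simp add: matrix_transform_def mult.assoc)

lemma regular_summability_scale_rows_iff:
  assumes B: "regular_summability B"
  shows "regular_summability (\<lambda>i j. w i * B i j) \<longleftrightarrow> w \<longlonglongrightarrow> 1"
proof -
  have summ: "summable (\<lambda>j. B i j * s j)" and tends: "matrix_transform B s \<longlonglongrightarrow> l"
    if "s \<longlonglongrightarrow> l" for s l i
    using B that by (auto simp: regular_summability_iff_tendsto)
  have transform: "matrix_transform (\<lambda>i j. w i * B i j) s = (\<lambda>i. w i * matrix_transform B s i)"
    if "s \<longlonglongrightarrow> l" for s l
    using summ[OF that] by (auto simp: matrix_transform_scale_rows)
  show ?thesis
  proof
    assume w: "w \<longlonglongrightarrow> 1"
    show "regular_summability (\<lambda>i j. w i * B i j)"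
      unfolding regular_summability_iff_tendsto
    proof (intro allI impI conjI)
      fix s :: "nat \<Rightarrow> complex" and l i
      assume s: "s \<longlonglongrightarrow> l"
      show "summable (\<lambda>j. w i * B i j * s j)"
        using summable_mult[OF summ[OF s], of "w i" i] by (simp add: mult.assoc)
      show "matrix_transform (\<lambda>i j. w i * B i j) s \<longlonglongrightarrow> l"
        using tendsto_mult[OF w tends[OF s]] by (simp add: transform[OF s])
    qed
  next
    assume wB: "regular_summability (\<lambda>i j. w i * B i j)"
    let ?r = "matrix_transform B (\<lambda>_. 1)"
    have one: "(\<lambda>_. 1 :: complex) \<longlonglongrightarrow> 1"
      by simp
    have r: "?r \<longlonglongrightarrow> 1"
      by (rule tends[OF one])
    have wr: "(\<lambda>i. w i * ?r i) \<longlonglongrightarrow> 1"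
      using wB one unfolding regular_summability_iff_tendsto transform[OF one, symmetric] by blast
    have "\<forall>\<^sub>F i in sequentially. ?r i \<noteq> 0"
      using tendsto_imp_eventually_ne[OF r] by simp
    then have "\<forall>\<^sub>F i in sequentially. w i * ?r i / ?r i = w i"
      by eventually_elim simp
    moreover have "(\<lambda>i. w i * ?r i / ?r i) \<longlonglongrightarrow> 1"
      using tendsto_divide[OF wr r] by simp
    ultimately show "w \<longlonglongrightarrow> 1"
      by (rule Lim_transform_eventually[rotated])
  qed
qed

theorem proposition1:
  fixes A :: "nat \<Rightarrow> nat \<Rightarrow> complex" and g :: "complex fps" and z :: complex
  assumes "regular_summability A"
  shows "(\<lambda>i. fps_nth g i * z ^ i) \<longlonglongrightarrow> 1 \<longleftrightarrow> regular_summability (P_C A g z)"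
proof -
  have "P_C A g z = (\<lambda>i j. (fps_nth g i * z ^ i) * A i j)"
    by (simp add: fun_eq_iff P_C_def)
  then show ?thesis
    using regular_summability_scale_rows_iff[OF assms, of "\<lambda>i. fps_nth g i * z ^ i"] by simp
qed

end
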